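(* For every integer $n \geq 59$, there is a regular $K_5$-saturated graph with $n$ vertices.
   Context: All graphs are finite and simple. A graph $G$ is $K_5$-saturated if $G$ contains no subgraph isomorphic to $K_5$ (the complete graph on 5 vertices), but adding any edge between two nonadjacent vertices creates a $K_5$. A graph is regular if all its vertices have the same degree. *)

theory Defs
  imports "Graph_Theory.Graph_Theory"
begin

(* A finite simple graph is a pair_graph of the Graph_Theory library: the edge {u, v} is
   represented by the two arcs (u, v) and (v, u).  complete_digraph r H is the library's
   predicate "H is a K_r"; it holds for every isomorphic copy of K_r, on any vertices. *)

definition has_complete_subgraph :: "nat \<Rightarrow> 'a pair_pre_digraph \<Rightarrow> bool" where
  "has_complete_subgraph r G \<longleftrightarrow>
     (\<exists>H :: 'a pair_pre_digraph. subgraph (with_proj H) (with_proj G) \<and> complete_digraph r (with_proj H))"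

definition add_edge :: "'a \<Rightarrow> 'a \<Rightarrow> 'a pair_pre_digraph \<Rightarrow> 'a pair_pre_digraph" where
  "add_edge u v G = G\<lparr>parcs := parcs G \<union> {(u, v), (v, u)}\<rparr>"

definition complete_saturated :: "nat \<Rightarrow> 'a pair_pre_digraph \<Rightarrow> bool" where
  "complete_saturated r G \<longleftrightarrow>
     \<not> has_complete_subgraph r G \<and>
     (\<forall>u \<in> pverts G. \<forall>v \<in> pverts G. u \<noteq> v \<longrightarrow> (u, v) \<notin> parcs G \<longrightarrow>
        has_complete_subgraph r (add_edge u v G))"

(* The arcs leaving v in a pair_graph correspond to the edges at v, so out_degree is the
   degree of v. *)

definition regular_graph :: "'a pair_pre_digraph \<Rightarrow> bool" where
  "regular_graph G \<longleftrightarrow> (\<exists>d. \<forall>v \<in> pverts G. out_degree (with_proj G) v = d)"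

end

theory Submission
  imports Defs
begin

text \<open>
  The join of a \<open>K\<^bsub>p+1\<^esub>\<close>-saturated and a \<open>K\<^bsub>q+1\<^esub>\<close>-saturated graph is
  \<open>K\<^bsub>p+q+1\<^esub>\<close>-saturated, so it suffices to join two \<open>K\<^bsub>3\<^esub>\<close>-saturated regular
  graphs for which order minus degree is the same.  A circulant graph is \<open>K\<^bsub>3\<^esub>\<close>-saturated
  iff its connection set is sum-free and every other nonzero residue is a sum of two of its
  elements.  Such a set is obtained from the middle third of \<open>\<int>/n\<close> by stretching both ends with
  step two: for \<open>n = 3k + 2 - i\<close> this gives degree \<open>k + 1 - i\<close> whenever \<open>k > 3i\<close>.  The difference
  \<open>2k + 1\<close> does not depend on \<open>i\<close>, and joining the graphs for \<open>i\<close> and \<open>j\<close> with \<open>i, j \<le> 3\<close> yields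
  every order \<open>6k + 4 - (i + j)\<close>, hence every residue class modulo 6.
\<close>

section \<open>Cliques\<close>

text \<open>Bare vertex sets stand in for witnessing subgraphs, so that they can be cut down by
  intersection and combined by union.\<close>

definition clique :: "'a pair_pre_digraph \<Rightarrow> 'a set \<Rightarrow> bool" where
  "clique G W \<longleftrightarrow> finite W \<and> W \<subseteq> pverts G \<and> (\<forall>u\<in>W. \<forall>v\<in>W. u \<noteq> v \<longrightarrow> (u, v) \<in> parcs G)"

lemma clique_subset: "clique G W \<Longrightarrow> U \<subseteq> W \<Longrightarrow> clique G U"
  by (auto simp: clique_def intro: finite_subset)

lemma has_complete_subgraph_iff_clique:
  assumes "pair_wf_digraph G"
  shows "has_complete_subgraph r G \<longleftrightarrow> (\<exists>W. clique G W \<and> card W = r)"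
proof
  assume "has_complete_subgraph r G"
  then obtain H :: "'a pair_pre_digraph" where H: "subgraph H G" "complete_digraph r (with_proj H)"
    unfolding has_complete_subgraph_def by blast
  then have "clique G (pverts H) \<and> card (pverts H) = r"
    by (auto simp: complete_digraph_pair_def subgraph_def clique_def)
  then show "\<exists>W. clique G W \<and> card W = r" by blast
next
  assume "\<exists>W. clique G W \<and> card W = r"
  then obtain W where W: "clique G W" "card W = r" by blast
  define H where "H = \<lparr>pverts = W, parcs = {(u, v). (u, v) \<in> W \<times> W \<and> u \<noteq> v}\<rparr>"
  have "pair_wf_digraph H" by unfold_locales (auto simp: H_def)
  then have "subgraph H G" using W assms
    by (auto simp: subgraph_def wf_digraph_wp_iff clique_def H_def)
  moreover have "complete_digraph r (with_proj H)"
    using W by (auto simp: complete_digraph_pair_def clique_def H_def)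
  ultimately show "has_complete_subgraph r G" unfolding has_complete_subgraph_def by blast
qed

lemma pair_wf_digraph_add_edge:
  assumes "pair_wf_digraph G" "u \<in> pverts G" "v \<in> pverts G"
  shows "pair_wf_digraph (add_edge u v G)"
proof -
  interpret pair_wf_digraph G by fact
  show ?thesis using assms(2,3)
    by unfold_locales (auto simp: add_edge_def dest: wellformed')
qed

lemma complete_saturated_iff_clique:
  assumes "pair_wf_digraph G"
  shows "complete_saturated r G \<longleftrightarrow>
    (\<nexists>W. clique G W \<and> card W = r) \<and>
    (\<forall>u \<in> pverts G. \<forall>v \<in> pverts G. u \<noteq> v \<longrightarrow> (u, v) \<notin> parcs G \<longrightarrow>
        (\<exists>W. clique (add_edge u v G) W \<and> card W = r))"
  using assms by (auto simp: complete_saturated_def has_complete_subgraph_iff_clique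
      pair_wf_digraph_add_edge)

lemma pair_graphI:
  assumes "finite (pverts G)" "\<And>u v. (u, v) \<in> parcs G \<Longrightarrow> u \<in> pverts G \<and> u \<noteq> v \<and> (v, u) \<in> parcs G"
  shows "pair_graph G"
proof -
  have "u \<in> pverts G \<and> v \<in> pverts G" if "(u, v) \<in> parcs G" for u v
    using that assms(2)[of u v] assms(2)[of v u] by simp
  then have arcs: "parcs G \<subseteq> pverts G \<times> pverts G" by auto
  then have "finite (parcs G)" using assms(1) by (blast intro: finite_subset)
  then show ?thesis using assms arcs
    by unfold_locales (auto simp: symmetric_def sym_def)
qed

section \<open>Joins\<close>

definition join :: "'a pair_pre_digraph \<Rightarrow> 'a pair_pre_digraph \<Rightarrow> 'a pair_pre_digraph" where
  "join G H = \<lparr>pverts = pverts G \<union> pverts H,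
    parcs = parcs G \<union> parcs H \<union> pverts G \<times> pverts H \<union> pverts H \<times> pverts G\<rparr>"

lemma join_commute: "join G H = join H G"
  by (auto simp: join_def)

lemma pair_graph_join:
  assumes "pair_graph G" "pair_graph H" "pverts G \<inter> pverts H = {}"
  shows "pair_graph (join G H)"
proof -
  interpret G: pair_graph G by fact
  interpret H: pair_graph H by fact
  show ?thesis using assms(3)
    by (intro pair_graphI)
      (auto simp: join_def dest: G.wellformed' H.wellformed' G.pair_no_loops H.pair_no_loops
        G.arcs_symmetric H.arcs_symmetric)
qed

lemma out_degree_join:
  assumes "pair_graph G" "pair_graph H" "pverts G \<inter> pverts H = {}" "v \<in> pverts G"
  shows "out_degree (with_proj (join G H)) v = out_degree (with_proj G) v + card (pverts H)"
proof -
  interpret G: pair_graph G by fact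
  interpret H: pair_graph H by fact
  have "out_arcs (join G H) v = out_arcs G v \<union> Pair v ` pverts H"
    using assms(3,4) by (auto simp: out_arcs_def join_def dest: H.wellformed')
  moreover have "out_arcs G v \<inter> Pair v ` pverts H = {}"
    using assms(3) by (auto simp: out_arcs_def dest: G.wellformed')
  moreover have "card (Pair v ` pverts H) = card (pverts H)"
    by (simp add: card_image inj_on_def)
  ultimately show ?thesis
    by (simp add: out_degree_def card_Un_disjoint G.finite_out_arcs H.pair_finite_verts)
qed

lemma clique_join:
  assumes "clique G W" "clique H U"
  shows "clique (join G H) (W \<union> U)"
  using assms by (auto simp: clique_def join_def)

lemma add_edge_join: "add_edge u v (join G H) = join (add_edge u v G) H"
  by (auto simp: add_edge_def join_def)

lemma clique_of_join:
  assumes "pair_graph G" "pair_graph H" "pverts G \<inter> pverts H = {}" "clique (join G H) W"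
  shows "clique G (W \<inter> pverts G)"
proof -
  interpret H: pair_graph H by fact
  have "(u, v) \<in> parcs G"
    if "(u, v) \<in> parcs (join G H)" "u \<in> pverts G" "v \<in> pverts G" for u v
    using that assms(3) by (auto simp: join_def dest: H.wellformed')
  then show ?thesis using assms(4) by (auto simp: clique_def)
qed

text \<open>Any larger clique would contain one of size exactly \<open>Suc p\<close>.\<close>

lemma card_clique_le:
  assumes "\<nexists>W. clique G W \<and> card W = Suc p" "clique G W"
  shows "card W \<le> p"
proof (rule ccontr)
  assume "\<not> card W \<le> p"
  then obtain U where "U \<subseteq> W" "card U = Suc p"
    by (metis not_less_eq_eq obtain_subset_with_card_n)
  then show False using assms clique_subset by blast
qed

text \<open>The new edge completes a clique of size \<open>Suc p\<close> on the side of
  \<open>G\<close>, and each vertex of \<open>U\<close> is adjacent to all of it.\<close>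

lemma clique_add_edge_join:
  assumes "pverts G \<inter> pverts H = {}" "complete_saturated (Suc p) G" "pair_wf_digraph G"
    and "clique H U" "card U = q"
    and "u \<in> pverts G" "v \<in> pverts G" "u \<noteq> v" "(u, v) \<notin> parcs G"
  shows "\<exists>W. clique (add_edge u v (join G H)) W \<and> card W = Suc (p + q)"
proof -
  obtain W where W: "clique (add_edge u v G) W" "card W = Suc p"
    using assms(2,6-9) unfolding complete_saturated_iff_clique[OF assms(3)] by blast
  have "W \<inter> U = {}" "finite W" "finite U"
    using W(1) assms(1,4) by (auto simp: clique_def add_edge_def)
  then have "card (W \<union> U) = Suc (p + q)" using W(2) assms(5) by (simp add: card_Un_disjoint)
  then show ?thesis using clique_join[OF W(1) assms(4)] by (auto simp: add_edge_join)
qed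

text \<open>A clique splits into traces of sizes at most \<open>p\<close> and \<open>q\<close>. A
  nonadjacent pair lies on one side, where its edge completes a clique that the other side extends.
  The assumed cliques of sizes \<open>p\<close> and \<open>q\<close> supply this extension;
  saturation alone does not, as it holds vacuously for small complete graphs.\<close>

lemma complete_saturated_join:
  assumes "pair_graph G" "pair_graph H" "pverts G \<inter> pverts H = {}"
    and "complete_saturated (Suc p) G" "has_complete_subgraph p G"
    and "complete_saturated (Suc q) H" "has_complete_subgraph q H"
  shows "complete_saturated (Suc (p + q)) (join G H)"
proof -
  interpret G: pair_graph G by fact
  interpret H: pair_graph H by fact
  interpret J: pair_graph "join G H" using assms(1-3) by (rule pair_graph_join)
  note wf = G.pair_wf_digraph_axioms H.pair_wf_digraph_axioms
  obtain A B where AB: "clique G A" "card A = p" "clique H B" "card B = q"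
    using assms(5,7) wf by (auto simp: has_complete_subgraph_iff_clique)
  have "card W \<le> p + q" if W: "clique (join G H) W" for W
  proof -
    have "clique G (W \<inter> pverts G)" "clique H (W \<inter> pverts H)"
      using clique_of_join[OF assms(1-3) W] clique_of_join[OF assms(2,1), of W] assms(3) W
      by (auto simp: join_commute)
    then have "card (W \<inter> pverts G) \<le> p" "card (W \<inter> pverts H) \<le> q"
      using assms(4,6) wf by (auto simp: complete_saturated_iff_clique intro!: card_clique_le)
    moreover have "W = (W \<inter> pverts G) \<union> (W \<inter> pverts H)"
      using W by (auto simp: clique_def join_def)
    ultimately show ?thesis by (metis add_mono card_Un_le le_trans)
  qed
  moreover have "\<exists>W. clique (add_edge u v (join G H)) W \<and> card W = Suc (p + q)"
    if uv: "u \<in> pverts (join G H)" "v \<in> pverts (join G H)" "u \<noteq> v" "(u, v) \<notin> parcs (join G H)" for u v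
  proof -
    from uv consider "u \<in> pverts G" "v \<in> pverts G" "(u, v) \<notin> parcs G"
      | "u \<in> pverts H" "v \<in> pverts H" "(u, v) \<notin> parcs H"
      by (auto simp: join_def)
    then show ?thesis
    proof cases
      case 1
      then show ?thesis
        using clique_add_edge_join[OF assms(3,4) wf(1) AB(3,4)] uv(3) by blast
    next
      case 2
      have "pverts H \<inter> pverts G = {}" using assms(3) by blast
      from clique_add_edge_join[OF this assms(6) wf(2) AB(1,2)] 2 uv(3) show ?thesis
        by (simp add: join_commute add.commute)
    qed
  qed
  ultimately show ?thesis
    using J.pair_wf_digraph_axioms by (fastforce simp: complete_saturated_iff_clique)
qed

section \<open>Circulant graphs\<close>

text \<open>
  The vertices are placed at an offset so that two circulants can be made disjoint.  Differences are
  taken in \<open>\<nat>\<close>, which is adequate for \<open>S \<subseteq> {0<..<n}\<close> closed under \<open>s \<mapsto> n - s\<close>.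
\<close>

definition circulant :: "nat \<Rightarrow> nat \<Rightarrow> nat set \<Rightarrow> nat pair_pre_digraph" where
  "circulant b n S = \<lparr>pverts = {b..<b + n},
    parcs = {(u, v). u \<in> {b..<b + n} \<and> v \<in> {b..<b + n} \<and> (u < v \<and> v - u \<in> S \<or> v < u \<and> u - v \<in> S)}\<rparr>"

lemma pair_graph_circulant: "pair_graph (circulant b n S)"
  by (rule pair_graphI) (auto simp: circulant_def)

lemma pverts_circulant [simp]: "pverts (circulant b n S) = {b..<b + n}"
  by (simp add: circulant_def)

lemma circulant_arcI:
  assumes "b \<le> u" "u < v" "v < b + n" "v - u \<in> S"
  shows "(u, v) \<in> parcs (circulant b n S)" "(v, u) \<in> parcs (circulant b n S)"
  using assms by (auto simp: circulant_def)

lemma circulant_arcD: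
  assumes "(u, v) \<in> parcs (circulant b n S)" "u < v"
  shows "v - u \<in> S"
  using assms by (simp add: circulant_def)

locale connection_set =
  fixes n :: nat and S :: "nat set"
  assumes range: "S \<subseteq> {0<..<n}"
    and minus: "s \<in> S \<Longrightarrow> n - s \<in> S"
begin

lemma out_degree_circulant:
  assumes "v \<in> {b..<b + n}"
  shows "out_degree (with_proj (circulant b n S)) v = card S"
proof -
  \<comment> \<open>\<open>f s\<close> is the arc from \<open>v\<close> to its rotation by
    \<open>s\<close>, wrapped back into the interval. A neighbour \<open>w\<close> below
    \<open>v\<close> is reached by the rotation \<open>n - (v - w)\<close>.\<close>
  define f where "f s = (v, if v + s < b + n then v + s else v + s - n)" for s
  have "out_arcs (circulant b n S) v = f ` S"
  proof (intro set_eqI iffI)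
    fix e assume "e \<in> out_arcs (circulant b n S) v"
    then obtain w where w: "e = (v, w)" "w \<in> {b..<b + n}" "v < w \<and> w - v \<in> S \<or> w < v \<and> v - w \<in> S"
      by (auto simp: out_arcs_def circulant_def)
    from w(3) show "e \<in> f ` S"
    proof
      assume "v < w \<and> w - v \<in> S"
      moreover from this have "e = f (w - v)" using w by (auto simp: f_def)
      ultimately show ?thesis by blast
    next
      assume vw: "w < v \<and> v - w \<in> S"
      then have "n - (v - w) \<in> S" using minus by blast
      moreover have "e = f (n - (v - w))" using w vw assms by (auto simp: f_def)
      ultimately show ?thesis by blast
    qed
  next
    fix e assume "e \<in> f ` S"
    then obtain s where s: "s \<in> S" "e = f s" by blast
    have "0 < s" "s < n" "n - s \<in> S" using s(1) range minus by auto
    moreover have "v - (v + s - n) = n - s" if "b + n \<le> v + s" using that \<open>s < n\<close> by simp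
    ultimately show "e \<in> out_arcs (circulant b n S) v" using s assms
      by (auto simp: f_def out_arcs_def circulant_def)
  qed
  moreover have "inj_on f S"
    using range by (auto simp: inj_on_def f_def split: if_splits)
  ultimately show ?thesis by (simp add: out_degree_def card_image)
qed

text \<open>In a triangle with vertices in increasing order, two differences sum to the third,
  against sum-freeness. For nonadjacent \<open>u < v\<close>, writing \<open>v - u\<close> or its
  negative modulo \<open>n\<close> as \<open>s + t\<close> yields a common neighbour, hence a
  triangle once the edge is added.\<close>

lemma circulant_triangle_saturated:
  assumes sum_free: "\<And>s t. s \<in> S \<Longrightarrow> t \<in> S \<Longrightarrow> s + t \<notin> S"
    and complete: "\<And>x. 0 < x \<Longrightarrow> x < n \<Longrightarrow> x \<notin> S \<Longrightarrow> \<exists>s\<in>S. \<exists>t\<in>S. s + t = x \<or> s + t = n - x"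
  shows "complete_saturated 3 (circulant b n S)"
proof -
  let ?G = "circulant b n S"
  interpret pair_graph ?G by (rule pair_graph_circulant)
  have no_triangle: False if "x < y" "y < z" "(x, y) \<in> parcs ?G" "(y, z) \<in> parcs ?G" "(x, z) \<in> parcs ?G" for x y z
  proof -
    have "y - x \<in> S" "z - y \<in> S" "z - x \<in> S" using that by (auto intro: circulant_arcD)
    moreover have "(y - x) + (z - y) = z - x" using that by simp
    ultimately show False using sum_free by metis
  qed
  have "card W \<noteq> 3" if W: "clique ?G W" for W
  proof
    assume "card W = 3"
    then obtain x y z where "W = {x, y, z}" "x \<noteq> y" "x \<noteq> z" "y \<noteq> z" by (auto simp: card_3_iff)
    then have "\<exists>x y z. x < y \<and> y < z \<and> {x, y, z} \<subseteq> W" by (auto simp: neq_iff)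
    then obtain x y z where "x < y" "y < z" "{x, y, z} \<subseteq> W" by blast
    then show False using W no_triangle[of x y z] by (auto simp: clique_def)
  qed
  moreover have "\<exists>W. clique (add_edge u v ?G) W \<and> card W = 3"
    if uv: "u \<in> pverts ?G" "v \<in> pverts ?G" "u < v" "(u, v) \<notin> parcs ?G" for u v
  proof -
    have "v - u \<notin> S" "0 < v - u" "v - u < n" using uv by (auto simp: circulant_def)
    then obtain s t where st: "s \<in> S" "t \<in> S" "s + t = v - u \<or> s + t = n - (v - u)"
      using complete by blast
    have pos: "0 < s" "0 < t" "s < n" "t < n" using st(1,2) range by auto
    have bounds: "b \<le> u" "u < b + n" "b \<le> v" "v < b + n" using uv(1,2) by simp_all
    have "\<exists>w. (u, w) \<in> parcs ?G \<and> (v, w) \<in> parcs ?G"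
    proof -
      \<comment> \<open>The common neighbour is \<open>u + s\<close>, between \<open>u\<close> and
        \<open>v\<close>, in the first case. In the others it is \<open>v + s\<close> modulo
        \<open>n\<close>, which lies above \<open>v\<close> or, after wrapping, below
        \<open>u\<close>.\<close>
      consider "s + t = v - u" | "s + t = n - (v - u)" "v + s < b + n"
        | "s + t = n - (v - u)" "b + n \<le> v + s" using st(3) by linarith
      then show ?thesis
      proof cases
        case 1
        then have "v - (u + s) = t" "u + s < v" using pos uv(3) by linarith+
        then have "(u, u + s) \<in> parcs ?G" "(v, u + s) \<in> parcs ?G"
          using st(1,2) bounds pos(1) by (auto intro: circulant_arcI(1) circulant_arcI(2))
        then show ?thesis by blast
      next
        case 2
        then have "v + s - u = n - t" using bounds uv(3) by linarith
        then have "(u, v + s) \<in> parcs ?G" "(v, v + s) \<in> parcs ?G"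
          using st(1) minus[OF st(2)] bounds uv(3) pos(1) 2(2) by (auto intro: circulant_arcI(1))
        then show ?thesis by blast
      next
        case 3
        define w where "w = v + s - n"
        have w: "w + n = v + s" using 3(2) by (simp add: w_def)
        have "u - w = t" "v - w = n - s" "w < u" "w < v" "b \<le> w"
          using w 3 uv(3) bounds pos by linarith+
        then have "(u, w) \<in> parcs ?G" "(v, w) \<in> parcs ?G"
          using st(2) minus[OF st(1)] bounds by (auto intro: circulant_arcI(2))
        then show ?thesis by blast
      qed
    qed
    then obtain w where w: "(u, w) \<in> parcs ?G" "(v, w) \<in> parcs ?G" by blast
    have "u \<noteq> w" "v \<noteq> w" using w by (auto dest: pair_no_loops)
    then have "card {u, v, w} = 3" using uv by simp
    moreover have "clique (add_edge u v ?G) {u, v, w}"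
      using w uv by (auto simp: clique_def add_edge_def dest: arcs_symmetric wellformed')
    ultimately show ?thesis by blast
  qed
  moreover have "add_edge u v ?G = add_edge v u ?G" for u v
    by (simp add: add_edge_def insert_commute)
  ultimately show ?thesis
    unfolding complete_saturated_iff_clique[OF pair_wf_digraph_axioms]
    by (metis arcs_symmetric nat_neq_iff)
qed

lemma circulant_has_edge:
  assumes "S \<noteq> {}"
  shows "has_complete_subgraph 2 (circulant b n S)"
proof -
  interpret pair_graph "circulant b n S" by (rule pair_graph_circulant)
  obtain s where "s \<in> S" using assms by blast
  moreover from this have "0 < s" "s < n" using range by auto
  ultimately have "clique (circulant b n S) {b, b + s}" "card {b, b + s} = 2"
    by (auto simp: clique_def circulant_def)
  then show ?thesis by (auto simp: has_complete_subgraph_iff_clique[OF pair_wf_digraph_axioms])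
qed

end

section \<open>A family of complete sum-free sets\<close>

text \<open>For \<open>i = 0\<close> this is the middle third of the residues modulo
  \<open>3 * m - 1\<close>. For \<open>2 * i < m\<close> it is the full block from
  \<open>m + 2 * i\<close> to \<open>2 * m - 1\<close>, flanked on each side by \<open>i\<close>
  elements in steps of two.\<close>

definition stretched_third :: "nat \<Rightarrow> nat \<Rightarrow> nat set" where
  "stretched_third m i = {s. m \<le> s \<and> s < 2 * m + 2 * i \<and>
     (s < m + 2 * i \<longrightarrow> even (s + m)) \<and> (2 * m \<le> s \<longrightarrow> odd s)}"

lemma card_stretched_third:
  assumes "2 * i \<le> m"
  shows "card (stretched_third m i) = m"
proof -
  let ?A = "(\<lambda>l. m + 2 * l) ` {..<i}" and ?B = "{m + 2 * i..<2 * m}"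
    and ?C = "(\<lambda>l. 2 * m + 1 + 2 * l) ` {..<i}"
  have "stretched_third m i = ?A \<union> ?B \<union> ?C"
  proof (intro set_eqI iffI)
    fix s assume s: "s \<in> stretched_third m i"
    consider "s < m + 2 * i" | "s \<in> ?B" | "2 * m \<le> s" by fastforce
    then show "s \<in> ?A \<union> ?B \<union> ?C"
    proof cases
      case 1
      with s have "m \<le> s" "even (s + m)" by (auto simp: stretched_third_def)
      then obtain l where "s + m = 2 * l" by (elim evenE)
      with 1 \<open>m \<le> s\<close> have "s = m + 2 * (l - m)" "l - m < i" by linarith+
      then show ?thesis by blast
    next
      case 3
      with s have "odd s" "s < 2 * m + 2 * i" by (auto simp: stretched_third_def)
      then obtain l where "s = 2 * l + 1" by (elim oddE)
      with 3 \<open>s < 2 * m + 2 * i\<close> have "s = 2 * m + 1 + 2 * (l - m)" "l - m < i" by linarith+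
      then show ?thesis by blast
    qed auto
  qed (use assms in \<open>auto simp: stretched_third_def\<close>)
  moreover have "card (?A \<union> ?B \<union> ?C) = card ?A + card ?B + card ?C"
    using assms by (subst card_Un_disjoint; auto)+
  moreover have "card ?A = i" "card ?C = i" by (simp_all add: card_image inj_on_def)
  ultimately show ?thesis using assms by simp
qed

text \<open>The reflection \<open>s\<close> to \<open>n - s\<close> preserves the full block and
  swaps the two ends: \<open>n - s\<close> is at least \<open>2 * m\<close> iff
  \<open>s < m + 2 * i\<close>, and is odd iff \<open>s + m\<close> is even.\<close>

lemma connection_set_stretched_third:
  assumes "2 * i < m"
  shows "connection_set (3 * m + 2 * i - 1) (stretched_third m i)"
  using assms by unfold_locales (auto simp: stretched_third_def)

text \<open>
  If \<open>s + t\<close> lies in the set, then \<open>s\<close>, \<open>t\<close> and \<open>n - (s + t)\<close> are elements with sum \<open>n\<close>.  As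
  \<open>n = 3m + 2i - 1\<close>, all three are below \<open>m + 2i\<close>, hence congruent to \<open>m\<close> modulo 2, but
  \<open>n\<close> is not congruent to \<open>3m\<close>.
\<close>

lemma stretched_third_sum_free:
  assumes "2 * i < m" "s \<in> stretched_third m i" "t \<in> stretched_third m i"
  shows "s + t \<notin> stretched_third m i"
proof
  assume st: "s + t \<in> stretched_third m i"
  have "m \<le> s" "m \<le> t" "s + t < 2 * m + 2 * i" using assms st by (auto simp: stretched_third_def)
  then have "s < m + 2 * i" "t < m + 2 * i" "2 * m \<le> s + t" by auto
  then have "even (s + m)" "even (t + m)" "odd (s + t)"
    using assms st by (auto simp: stretched_third_def)
  then show False by presburger
qed

text \<open>By reflection \<open>x\<close> may be taken to be at most \<open>n / 2\<close>, hence
  below \<open>2 * m\<close>. Then \<open>n - x\<close> is split as \<open>m + y\<close> where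
  possible; only odd \<open>x < 2 * i\<close> need another split.\<close>

lemma stretched_third_complete:
  fixes m i x :: nat
  defines "n \<equiv> 3 * m + 2 * i - 1" and "S \<equiv> stretched_third m i"
  assumes m: "2 * i + 2 \<le> m" and x: "0 < x" "x < n" "x \<notin> S"
  shows "\<exists>s\<in>S. \<exists>t\<in>S. s + t = x \<or> s + t = n - x"
proof -
  have half: "\<exists>s\<in>S. \<exists>t\<in>S. s + t = n - x" if x: "0 < x" "2 * x \<le> n" "x \<notin> S" for x
  proof -
    have mem: "s \<in> S \<longleftrightarrow> m \<le> s \<and> s < 2 * m + 2 * i \<and>
        (s < m + 2 * i \<longrightarrow> even (s + m)) \<and> (2 * m \<le> s \<longrightarrow> odd s)" for s
      by (simp add: S_def stretched_third_def)
    have "x < 2 * m" using x m by (simp add: n_def)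
    show ?thesis
    proof (cases "x < 2 * i \<and> odd x")
      case True
      \<comment> \<open>Here \<open>n - x - m\<close> is even and at least \<open>2 * m\<close>, so
        it is not in \<open>S\<close>. The bound \<open>2 * i + 2 \<le> m\<close> puts
        \<open>2 * m - 2\<close> into the full block instead.\<close>
      then have "2 * m - 2 \<in> S" "m + 2 * i + 1 - x \<in> S" using m by (auto simp: mem)
      moreover have "(2 * m - 2) + (m + 2 * i + 1 - x) = n - x" using True m by (simp add: n_def)
      ultimately show ?thesis by blast
    next
      case False
      \<comment> \<open>\<open>y\<close> is \<open>n - x - m\<close>. The three cases for
        \<open>x\<close> below place it in the lower end, the full block and the upper end,
        respectively.\<close>
      define y where "y = 2 * m + 2 * i - 1 - x"
      have y: "y + x + 1 = 2 * m + 2 * i" using \<open>x < 2 * m\<close> by (simp add: y_def)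
      have "even (y + x + 1)" unfolding y by simp
      then have parity: "odd y \<longleftrightarrow> even x" by simp
      from False x(3) \<open>x < 2 * m\<close> consider "m \<le> x" "x < m + 2 * i" "odd (x + m)"
        | "2 * i \<le> x" "x < m" | "x < 2 * i" "even x"
        by (fastforce simp: mem)
      then have "y \<in> S" using m x(1) y parity by cases (auto simp: mem)
      moreover have "m \<in> S" using m by (simp add: mem)
      moreover have "m + y = n - x" using y by (simp add: n_def)
      ultimately show ?thesis by blast
    qed
  qed
  show ?thesis
  proof (cases "2 * x \<le> n")
    case True
    then show ?thesis using half x by blast
  next
    case False
    interpret connection_set n S
      using m unfolding n_def S_def by (intro connection_set_stretched_third) simp
    have "n - x \<notin> S" using minus[of "n - x"] x by auto
    moreover have "2 * (n - x) \<le> n" "n - (n - x) = x" "0 < n - x" using False x by auto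
    ultimately show ?thesis using half[of "n - x"] by metis
  qed
qed

lemma circulant_stretched_third:
  fixes b m i :: nat
  defines "G \<equiv> circulant b (3 * m + 2 * i - 1) (stretched_third m i)"
  assumes m: "2 * i + 2 \<le> m"
  shows "complete_saturated 3 G" "has_complete_subgraph 2 G"
    and "v \<in> pverts G \<Longrightarrow> out_degree (with_proj G) v = m"
proof -
  interpret connection_set "3 * m + 2 * i - 1" "stretched_third m i"
    using m by (intro connection_set_stretched_third) simp
  show "complete_saturated 3 G" unfolding G_def
    using m stretched_third_sum_free stretched_third_complete
    by (intro circulant_triangle_saturated) auto
  have card: "card (stretched_third m i) = m" using m by (intro card_stretched_third) simp
  with m show "has_complete_subgraph 2 G" unfolding G_def by (intro circulant_has_edge) auto
  show "out_degree (with_proj G) v = m" if "v \<in> pverts G"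
    using that card out_degree_circulant by (simp add: G_def)
qed

section \<open>A regular join of each order\<close>

theorem theorem3p5:
  fixes n :: nat
  assumes "n \<ge> 59"
  shows "\<exists>G :: nat pair_pre_digraph.
           pair_graph G \<and> card (pverts G) = n \<and> regular_graph G \<and> complete_saturated 5 G"
proof -
  \<comment> \<open>This \<open>k\<close> gives \<open>6 * k - 1 \<le> n \<le> 6 * k + 4\<close>, so
    the deficit \<open>6 * k + 4 - n\<close> is at most 5 and splits into halves \<open>i\<close>
    and \<open>j\<close> of at most 3.\<close>
  define k where "k = (n + 1) div 6"
  define i where "i = (6 * k + 4 - n) div 2"
  define j where "j = 6 * k + 4 - n - i"
  define a where "a = k + 1 - i"
  define b where "b = k + 1 - j"
  define na where "na = 3 * a + 2 * i - 1"
  define nb where "nb = 3 * b + 2 * j - 1"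
  have "6 * k \<le> n + 1" "n + 1 < 6 + 6 * k"
    unfolding k_def by (rule times_div_less_eq_dividend, rule dividend_less_times_div) simp
  \<comment> \<open>The bound 59 enters here: \<open>2 * j + 2 \<le> k + 1 - j\<close> with
    \<open>j = 3\<close> requires \<open>k \<ge> 10\<close>.\<close>
  then have k: "10 \<le> k" "n \<le> 6 * k + 4" "6 * k \<le> n + 1" using assms by linarith+
  then have ij: "i \<le> 3" "j \<le> 3" "i + j = 6 * k + 4 - n" unfolding i_def j_def by auto
  have "a + i = k + 1" "b + j = k + 1" using k ij by (simp_all add: a_def b_def)
  moreover from this have ab: "2 * i + 2 \<le> a" "2 * j + 2 \<le> b" using k ij by linarith+
  moreover have "na + 1 = 3 * a + 2 * i" "nb + 1 = 3 * b + 2 * j" using ab by (simp_all add: na_def nb_def)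
  \<comment> \<open>Both \<open>na - a\<close> and \<open>nb - b\<close> equal
    \<open>2 * k + 1\<close>, so the two sides have equal degree in the join.\<close>
  ultimately have n: "na + nb = n" "a + nb = b + na" using k ij by linarith+
  define G where "G = circulant 0 na (stretched_third a i)"
  define H where "H = circulant na nb (stretched_third b j)"
  have graphs: "pair_graph G" "pair_graph H" by (simp_all add: G_def H_def pair_graph_circulant)
  have verts: "pverts G = {0..<na}" "pverts H = {na..<na + nb}" by (simp_all add: G_def H_def)
  then have disj: "pverts G \<inter> pverts H = {}" "pverts H \<inter> pverts G = {}" by auto
  have G: "complete_saturated 3 G" "has_complete_subgraph 2 G"
      "\<And>v. v \<in> pverts G \<Longrightarrow> out_degree (with_proj G) v = a"
    and H: "complete_saturated 3 H" "has_complete_subgraph 2 H"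
      "\<And>v. v \<in> pverts H \<Longrightarrow> out_degree (with_proj H) v = b"
    using circulant_stretched_third[OF ab(1)] circulant_stretched_third[OF ab(2)]
    by (simp_all add: G_def H_def na_def nb_def)
  have "out_degree (with_proj (join G H)) v = a + nb" if "v \<in> pverts (join G H)" for v
  proof (cases "v \<in> pverts G")
    case True
    then show ?thesis using out_degree_join[OF graphs disj(1)] G(3) verts by simp
  next
    case False
    then have "v \<in> pverts H" using that by (simp add: join_def)
    then show ?thesis using out_degree_join[OF graphs(2,1) disj(2)] H(3) verts n(2)
      by (simp add: join_commute)
  qed
  then have "regular_graph (join G H)" unfolding regular_graph_def by blast
  moreover have "complete_saturated 5 (join G H)"
    using complete_saturated_join[of G H 2 2] graphs disj(1) G(1,2) H(1,2)
    by (simp add: eval_nat_numeral)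
  moreover have "card (pverts (join G H)) = n"
    using n(1) by (simp add: join_def verts card_Un_disjoint ivl_disj_int)
  ultimately show ?thesis using pair_graph_join[OF graphs disj(1)] by blast
qed

end
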